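(* Let $S\subseteq\mathbb{Z}_2^n$ generate $\mathbb{Z}_2^n$, with $0\notin S$. If $S$ has the $\Theta$-property, then the cube-like graph $Q_S$ admits a unitary signing. Moreover, the unitary signing may be chosen so that every two-label $4$-cycle of $Q_S$ (that is, every $4$-cycle whose edge labels in cyclic order are $a,b,a,b$ for some $a,b\in S$ with $a\neq b$) has sign $-1$.
   Context: For $S\subseteq\mathbb{Z}_2^n$ with $0\notin S$, $Q_S$ is the (loopless, simple) graph with vertex set $\mathbb{Z}_2^n$ in which $x,y$ are adjacent iff $x+y\in S$; the element $x+y\in S$ is called the label of the edge $xy$. $\Theta$-property: $S\subseteq\mathbb{Z}_2^n$ has the $\Theta$-property if for any three pairwise disjoint subsets of $S$ whose element sums are equal, at least two of the three subsets have even size. (An empty subset is allowed; its sum is $0$.) A complex signing of a graph $G$ assigns to each ordered pair $(x,y)$ of adjacent vertices a value $\sigma(xy)\in\{1,-1,i,-i\}$ such that $\sigma(yx)=\overline{\sigma(xy)}$. Its adjacency matrix $M$, with $M_{xy}=\sigma(xy)$ for adjacent $x,y$ and $0$ otherwise, is Hermitian. For a $d$-regular graph the signing is called unitary if $M^2=dI$ (equivalently $M\overline{M}^{T}=dI$). The sign of a cycle $v_1v_2\cdots v_k$ traversed in this direction is $\prod_{j=1}^{k}\sigma(v_jv_{j+1})$ with $v_{k+1}=v_1$; the condition that the sign equals $-1$ does not depend on the direction. *)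

theory Defs
  imports
    "HOL-Analysis.Analysis"
    "HOL-Library.Z2"
    "HOL-Computational_Algebra.Group_Closure"
begin

text \<open>
  The group \<open>\<int>\<^sub>2\<^sup>n\<close> is the type \<open>bit ^ 'n\<close> with \<open>n = CARD('n)\<close>. Matrices indexed by its
  elements have type \<open>complex ^ (bit ^ 'n) ^ (bit ^ 'n)\<close>, which needs \<open>bit\<close> to be a finite type.
\<close>

instance bit :: finite
proof
  have "(UNIV :: bit set) \<subseteq> {0, 1}"
    by auto
  then show "finite (UNIV :: bit set)"
    by (rule finite_subset) simp
qed

text \<open>A graph on the vertex type \<open>'v\<close> is given by its adjacency relation.\<close>

definition cubelike_adj :: "(bit ^ 'n) set \<Rightarrow> bit ^ 'n \<Rightarrow> bit ^ 'n \<Rightarrow> bool" where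
  "cubelike_adj S x y \<longleftrightarrow> x + y \<in> S"

lemma cubelike_adj_sym: "cubelike_adj S x y \<Longrightarrow> cubelike_adj S y x"
  by (simp add: cubelike_adj_def add.commute)

lemma cubelike_adj_irrefl: "0 \<notin> S \<Longrightarrow> \<not> cubelike_adj S x x"
proof -
  have "x + x = 0"
    by (simp add: vec_eq_iff flip: mult_2)
  then show "0 \<notin> S \<Longrightarrow> \<not> cubelike_adj S x x"
    by (simp add: cubelike_adj_def)
qed

definition Theta_property :: "(bit ^ 'n) set \<Rightarrow> bool" where
  "Theta_property S \<longleftrightarrow>
     (\<forall>A B C. A \<subseteq> S \<and> B \<subseteq> S \<and> C \<subseteq> S
        \<and> A \<inter> B = {} \<and> A \<inter> C = {} \<and> B \<inter> C = {}
        \<and> \<Sum>A = \<Sum>B \<and> \<Sum>B = \<Sum>C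
      \<longrightarrow> even (card A) \<and> even (card B)
        \<or> even (card A) \<and> even (card C)
        \<or> even (card B) \<and> even (card C))"

definition regular_graph :: "('v \<Rightarrow> 'v \<Rightarrow> bool) \<Rightarrow> nat \<Rightarrow> bool" where
  "regular_graph adj d \<longleftrightarrow> (\<forall>x. finite {y. adj x y} \<and> card {y. adj x y} = d)"

text \<open>A signing is a total function; only its values on adjacent pairs are relevant.\<close>

definition complex_signing :: "('v \<Rightarrow> 'v \<Rightarrow> bool) \<Rightarrow> ('v \<Rightarrow> 'v \<Rightarrow> complex) \<Rightarrow> bool" where
  "complex_signing adj \<sigma> \<longleftrightarrow>
     (\<forall>x y. adj x y \<longrightarrow> \<sigma> x y \<in> {1, -1, \<i>, -\<i>} \<and> \<sigma> y x = cnj (\<sigma> x y))"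

definition signed_adjacency_matrix ::
    "('v \<Rightarrow> 'v \<Rightarrow> bool) \<Rightarrow> ('v \<Rightarrow> 'v \<Rightarrow> complex) \<Rightarrow> complex ^ 'v ^ 'v::finite" where
  "signed_adjacency_matrix adj \<sigma> = (\<chi> x y. if adj x y then \<sigma> x y else 0)"

text \<open>\<open>mat k\<close> is \<open>k\<close> times the identity matrix, and \<open>**\<close> is the matrix product.\<close>

definition unitary_signing ::
    "('v::finite \<Rightarrow> 'v \<Rightarrow> bool) \<Rightarrow> ('v \<Rightarrow> 'v \<Rightarrow> complex) \<Rightarrow> bool" where
  "unitary_signing adj \<sigma> \<longleftrightarrow>
     complex_signing adj \<sigma> \<and>
     (\<exists>d. regular_graph adj d \<and>
          signed_adjacency_matrix adj \<sigma> ** signed_adjacency_matrix adj \<sigma> = mat (of_nat d))"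

text \<open>A cycle is the list of its vertices in order of traversal, without repeating the first one.\<close>

definition is_cycle :: "('v \<Rightarrow> 'v \<Rightarrow> bool) \<Rightarrow> 'v list \<Rightarrow> bool" where
  "is_cycle adj vs \<longleftrightarrow>
     3 \<le> length vs \<and> distinct vs \<and>
     (\<forall>j < length vs. adj (vs ! j) (vs ! (Suc j mod length vs)))"

definition cycle_sign :: "('v \<Rightarrow> 'v \<Rightarrow> complex) \<Rightarrow> 'v list \<Rightarrow> complex" where
  "cycle_sign \<sigma> vs = (\<Prod>j < length vs. \<sigma> (vs ! j) (vs ! (Suc j mod length vs)))"

definition cycle_labels :: "(bit ^ 'n) list \<Rightarrow> (bit ^ 'n) list" where
  "cycle_labels vs = map (\<lambda>j. vs ! j + vs ! (Suc j mod length vs)) [0..<length vs]"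

definition two_label_4cycle :: "(bit ^ 'n) set \<Rightarrow> (bit ^ 'n) list \<Rightarrow> bool" where
  "two_label_4cycle S vs \<longleftrightarrow>
     is_cycle (cubelike_adj S) vs \<and> length vs = 4 \<and>
     (\<exists>a\<in>S. \<exists>b\<in>S. a \<noteq> b \<and> cycle_labels vs = [a, b, a, b])"

end

theory Submission
  imports Defs
begin

text \<open>
  The signing is sought in the form \<open>\<sigma> x (x + s) = c s * (-1) ^ g s x\<close>, where \<open>g s\<close> is a linear
  functional on \<open>\<int>\<^sub>2\<^sup>n\<close> and \<open>c s\<close> is \<open>1\<close> or \<open>\<i>\<close>, the latter when \<open>g s s = 1\<close>. The part of the
  adjacency matrix that belongs to the label \<open>s\<close> is then a Hermitian involution, and the parts
  for \<open>s \<noteq> t\<close> anticommute as soon as \<open>g s t + g t s = 1\<close>. The square of the matrix and the signs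
  of the two-label cycles follow from this.

  Choose a basis \<open>B \<subseteq> S\<close> and order it. For basis elements, let \<open>g s b = 1\<close> iff \<open>s < b\<close>. For
  \<open>s \<in> S - B\<close> the values of \<open>g s\<close> on \<open>B\<close> are forced by the anticommutation with the basis
  elements. For \<open>s, t \<in> S - B\<close> with supports \<open>P, Q \<subseteq> B\<close>, the remaining condition reads
  \<open>(1 + |P|) (1 + |Q|) = |P \<inter> Q|\<close> modulo \<open>2\<close>, which is the \<open>\<Theta>\<close>-property for the sets
  \<open>insert s (P - Q)\<close>, \<open>insert t (Q - P)\<close> and \<open>P \<inter> Q\<close>.
\<close>

section \<open>Preliminaries over \<open>\<int>\<^sub>2\<close>\<close>

lemma bit_add_self [simp]: "a + a = (0 :: bit)"
  by (cases a) simp_all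

lemma bit_add_self_left [simp]: "a + (a + b) = (b :: bit)"
  by (cases a; cases b) simp_all

lemma bit_vec_add_self [simp]: "x + x = (0 :: bit ^ 'n)"
  by (simp add: vec_eq_iff)

lemma bit_vec_add_self_left [simp]: "x + (x + y) = (y :: bit ^ 'n)"
  by (simp flip: add.assoc)

lemma of_nat_bit_eq: "of_nat k = (of_bool (odd k) :: bit)"
  by (induction k) auto

text \<open>This turns generation as a group into spanning as a vector space, so that a basis can be
  chosen inside \<open>S\<close>.\<close>

lemma group_closure_subset_span:
  fixes S :: "('a::field ^ 'n) set"
  shows "group_closure S \<subseteq> vec.span S"
proof
  fix x assume "x \<in> group_closure S"
  then show "x \<in> vec.span S"
    by induction (auto intro: vec.span_base vec.span_zero vec.span_diff)
qed

section \<open>The functionals\<close>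

text \<open>Since \<open>s = \<Sum>P\<close>, adding \<open>\<Sum>(P - Q)\<close> to
  \<open>s\<close> leaves the sum of \<open>P \<inter> Q\<close>, and likewise for \<open>t\<close>.
  Three disjoint sets with equal sums arise.\<close>

lemma Theta_property_parity:
  fixes S :: "(bit ^ 'n::finite) set"
  assumes Theta: "Theta_property S"
    and "P \<subseteq> S" "Q \<subseteq> S" "s \<in> S" "t \<in> S" "s \<noteq> t"
    and "s \<notin> P" "s \<notin> Q" "t \<notin> P" "t \<notin> Q"
    and "s = \<Sum>P" "t = \<Sum>Q"
  shows "(1 + of_nat (card P)) * (1 + of_nat (card Q)) = (of_nat (card (P \<inter> Q)) :: bit)"
proof -
  let ?A = "insert s (P - Q)" and ?B = "insert t (Q - P)" and ?C = "P \<inter> Q"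
  have fin: "finite X" for X :: "(bit ^ 'n) set"
    by simp
  have "\<Sum>P = \<Sum>?C + \<Sum>(P - Q)" "\<Sum>Q = \<Sum>?C + \<Sum>(Q - P)"
    by (simp_all add: sum.Int_Diff [of P _ Q] sum.Int_Diff [of Q _ P] Int_commute)
  then have "\<Sum>?A = \<Sum>?C" "\<Sum>?B = \<Sum>?C"
    using assms by (simp_all add: fin add.assoc)
  moreover have "?A \<inter> ?B = {}" "?A \<inter> ?C = {}" "?B \<inter> ?C = {}" "?A \<subseteq> S" "?B \<subseteq> S" "?C \<subseteq> S"
    using assms(2-10) by auto
  ultimately have "even (card ?A) \<and> even (card ?B) \<or> even (card ?A) \<and> even (card ?C)
      \<or> even (card ?B) \<and> even (card ?C)"
    using Theta unfolding Theta_property_def by presburger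
  moreover have "card ?A = Suc (card (P - Q))" "card ?B = Suc (card (Q - P))"
    using assms(7-10) by (simp_all add: fin)
  moreover have "card P = card ?C + card (P - Q)" "card Q = card ?C + card (Q - P)"
    using card_Int_Diff [of P Q] card_Int_Diff [of Q P] by (simp_all add: fin Int_commute)
  \<comment> \<open>With p, q, c the sizes of \<open>P - Q\<close>, \<open>Q - P\<close>,
    \<open>P \<inter> Q\<close>, the claim is (1 + c + p)(1 + c + q) = c modulo 2, which holds when
    two of 1 + p, 1 + q, c are even.\<close>
  ultimately show ?thesis
    by (cases "even (card (P \<inter> Q))"; cases "even (card (P - Q))"; cases "even (card (Q - P))")
       (simp_all add: of_nat_bit_eq)
qed

lemma Theta_property_functionals:
  fixes S :: "(bit ^ 'n::finite) set"
  assumes gen: "group_closure S = UNIV" and Theta: "Theta_property S"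
  obtains g :: "bit ^ 'n \<Rightarrow> bit ^ 'n \<Rightarrow> bit"
  where "\<And>s x y. g s (x + y) = g s x + g s y"
    and "\<And>s t. s \<in> S \<Longrightarrow> t \<in> S \<Longrightarrow> s \<noteq> t \<Longrightarrow> g s t + g t s = 1"
proof -
  have fin: "finite X" for X :: "(bit ^ 'n) set"
    by simp
  obtain B where B: "B \<subseteq> S" and indep: "vec.independent B" and "S \<subseteq> vec.span B"
    using vec.maximal_independent_subset .
  then have span: "vec.span B = UNIV"
    using gen group_closure_subset_span [of S] vec.span_minimal [OF _ vec.subspace_span] by blast
  define coord where "coord = vec.representation B"
  define P where "P s = {b\<in>B. coord s b = 1}" for s
  have coord_add: "coord (x + y) b = coord x b + coord y b" for x y b
    using indep span by (simp add: coord_def vec.representation_add)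
  have P_basis: "P s = {s}" if "s \<in> B" for s
    using that indep by (auto simp: P_def coord_def vec.representation_basis split: if_splits)
  have coord_sum: "(\<Sum>b\<in>B. coord s b * f b) = (\<Sum>b\<in>P s. f b)" for s f
  proof -
    have "(\<Sum>b\<in>B. coord s b * f b) = (\<Sum>b\<in>B. if coord s b = 1 then f b else 0)"
      by (intro sum.cong) auto
    then show ?thesis
      by (simp add: P_def sum.inter_filter fin)
  qed
  have sum_P: "\<Sum>(P s) = s" for s
  proof -
    have "s = (\<Sum>b\<in>B. coord s b *s b)"
      using indep span unfolding coord_def by (intro vec.sum_representation_eq [symmetric]) auto
    also have "\<dots> = (\<Sum>b\<in>B. if coord s b = 1 then b else 0)"
      by (intro sum.cong) auto
    finally show ?thesis
      by (simp add: P_def sum.inter_filter fin)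
  qed
  \<comment> \<open>The injection supplies the linear order of the basis.\<close>
  obtain h :: "bit ^ 'n \<Rightarrow> nat" where h: "inj h"
    using finite_imp_inj_to_nat_seg [of "UNIV :: (bit ^ 'n) set"] by auto
  \<comment> \<open>For \<open>b \<in> B\<close> the inner sum of the second branch is the value of
    \<open>g b s\<close>, so the branch is the forced value \<open>1 + g b s\<close>.\<close>
  define u :: "bit ^ 'n \<Rightarrow> bit ^ 'n \<Rightarrow> bit" where
    "u s b = (if s \<in> B then of_bool (h s < h b) else 1 + (\<Sum>a\<in>P s. of_bool (h b < h a)))" for s b
  define g where "g s x = (\<Sum>b\<in>B. coord x b * u s b)" for s x
  have g_eq: "g s x = (\<Sum>b\<in>P x. u s b)" for s x
    unfolding g_def by (rule coord_sum)
  \<comment> \<open>Exactly one comparison holds unless \<open>a = b\<close>, when both fail; this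
    diagonal correction later produces the size of \<open>P s \<inter> P t\<close>.\<close>
  have cmp: "of_bool (h b < h a) + of_bool (h a < h b) = (1 + of_bool (a = b) :: bit)" for a b
    using inj_eq [OF h, of a b] by (cases "h a" "h b" rule: linorder_cases) auto
  have g_basis: "g s t + g t s = 1" if "s \<in> B" "s \<noteq> t" for s t
  proof (cases "t \<in> B")
    case True
    then show ?thesis
      using that inj_eq [OF h, of s t] by (auto simp: g_eq P_basis u_def simp del: sum_of_bool_eq)
  next
    case False
    then show ?thesis
      using that by (simp add: g_eq P_basis u_def add.left_commute del: sum_of_bool_eq)
  qed
  have g_nonbasis: "g s t + g t s = 1"
    if "s \<in> S" "t \<in> S" "s \<noteq> t" "s \<notin> B" "t \<notin> B" for s t
  proof -
    \<comment> \<open>Exchanging the order of summation pairs each comparison with its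
      reverse.\<close>
    have "(\<Sum>b\<in>P t. \<Sum>a\<in>P s. of_bool (h b < h a)) + (\<Sum>b\<in>P s. \<Sum>a\<in>P t. of_bool (h b < h a))
        = (\<Sum>b\<in>P t. \<Sum>a\<in>P s. of_bool (h b < h a) + (of_bool (h a < h b) :: bit))"
      by (subst sum.swap [of _ "P t" "P s"]) (simp only: sum.distrib)
    also have "\<dots> = (\<Sum>b\<in>P t. \<Sum>a\<in>P s. 1 + of_bool (a = b))"
      by (simp only: cmp)
    also have "\<dots> = of_nat (card (P t)) * of_nat (card (P s))
        + (\<Sum>b\<in>P t. of_bool (b \<in> P s))"
    proof -
      have "(\<Sum>a\<in>P s. of_bool (a = b)) = (of_bool (b \<in> P s) :: bit)" for b
        by (simp add: of_bool_def fin)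
      then show ?thesis
        by (simp only: sum.distrib sum_constant mult_1_right)
    qed
    also have "(\<Sum>b\<in>P t. of_bool (b \<in> P s)) = (of_nat (card (P s \<inter> P t)) :: bit)"
      by (simp add: of_bool_def fin Int_commute flip: sum.inter_restrict)
    finally have "g s t + g t s = of_nat (card (P t)) + of_nat (card (P s))
        + of_nat (card (P t)) * of_nat (card (P s)) + of_nat (card (P s \<inter> P t))"
      by (simp only: g_eq u_def that if_False sum.distrib sum_constant mult_1_right mult_1_left
          ac_simps)
    moreover have "P s \<subseteq> B" "P t \<subseteq> B"
      by (auto simp: P_def)
    then have "(1 + of_nat (card (P s))) * (1 + of_nat (card (P t)))
        = (of_nat (card (P s \<inter> P t)) :: bit)"
      using that B by (intro Theta_property_parity [OF Theta, of _ _ s t]) (auto simp: sum_P)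
    \<comment> \<open>Modulo 2, p + q + pq = 1 + (1 + p)(1 + q), and the product cancels against the
      size of the intersection.\<close>
    ultimately show ?thesis
      by (cases "of_nat (card (P s)) :: bit"; cases "of_nat (card (P t)) :: bit") auto
  qed
  show thesis
  proof (rule that [of g])
    show "g s (x + y) = g s x + g s y" for s x y
      by (simp only: g_def coord_add distrib_right sum.distrib)
    show "g s t + g t s = 1" if "s \<in> S" "t \<in> S" "s \<noteq> t" for s t
      using that g_basis [of s t] g_basis [of t s] g_nonbasis [of s t] by (metis add.commute)
  qed
qed

section \<open>The signing\<close>

definition bit_sign :: "bit \<Rightarrow> complex" where
  "bit_sign a = (if a = 1 then -1 else 1)"

text \<open>A square root of \<open>bit_sign a\<close>, of modulus 1; multiplication by
  \<open>bit_sign a\<close> therefore conjugates it.\<close>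

definition bit_root :: "bit \<Rightarrow> complex" where
  "bit_root a = (if a = 1 then \<i> else 1)"

lemma bit_sign_add: "bit_sign (a + b) = bit_sign a * bit_sign b"
  by (cases a; cases b) (simp_all add: bit_sign_def)

lemma bit_root_mult_sign: "bit_root a * bit_sign a = cnj (bit_root a)"
  by (simp add: bit_root_def bit_sign_def)

lemma cnj_bit_sign [simp]: "cnj (bit_sign a) = bit_sign a"
  by (simp add: bit_sign_def)

lemma bit_root_mult_sign_mem: "bit_root a * bit_sign b \<in> {1, -1, \<i>, -\<i>}"
  by (simp add: bit_root_def bit_sign_def)

definition label_signing ::
    "(bit ^ 'n \<Rightarrow> bit ^ 'n \<Rightarrow> bit) \<Rightarrow> bit ^ 'n \<Rightarrow> bit ^ 'n \<Rightarrow> complex" where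
  "label_signing g x y = bit_root (g (x + y) (x + y)) * bit_sign (g (x + y) x)"

lemma label_signing_add:
  "label_signing g x (x + s) = bit_root (g s s) * bit_sign (g s x)"
  by (simp add: label_signing_def)

lemma regular_cubelike:
  fixes S :: "(bit ^ 'n::finite) set"
  shows "regular_graph (cubelike_adj S) (card S)"
proof -
  have "{y. cubelike_adj S x y} = (+) x ` S" for x
    by (force simp: cubelike_adj_def image_iff)
  then show ?thesis
    by (simp add: regular_graph_def card_image)
qed

locale anticommuting_functionals =
  fixes S :: "(bit ^ 'n::finite) set" and g :: "bit ^ 'n \<Rightarrow> bit ^ 'n \<Rightarrow> bit"
  assumes g_add: "g s (x + y) = g s x + g s y"
    and g_anticomm: "s \<in> S \<Longrightarrow> t \<in> S \<Longrightarrow> s \<noteq> t \<Longrightarrow> g s t + g t s = 1"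
begin

text \<open>Moving the base point from \<open>x\<close> to \<open>x + s\<close> contributes the
  factor \<open>bit_sign (g s s)\<close>, which conjugates \<open>bit_root (g s s)\<close>.\<close>

lemma label_signing_cnj: "label_signing g y x = cnj (label_signing g x y)"
proof -
  define s where "s = x + y"
  then have y: "y = x + s" and x: "x = y + s"
    by (simp_all add: add.left_commute [of y])
  have "label_signing g y x = bit_root (g s s) * bit_sign (g s (x + s))"
    using label_signing_add [of g y s] by (simp flip: x y)
  also have "\<dots> = cnj (bit_root (g s s) * bit_sign (g s x))"
    by (simp only: g_add bit_sign_add complex_cnj_mult cnj_bit_sign ac_simps
        flip: bit_root_mult_sign)
  finally show ?thesis
    by (simp add: y label_signing_add)
qed

lemma label_signing_mult_cnj: "label_signing g x y * cnj (label_signing g x y) = 1"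
  by (simp add: label_signing_def bit_root_def bit_sign_def)

lemma complex_signing: "complex_signing (cubelike_adj S) (label_signing g)"
  unfolding complex_signing_def
  using label_signing_cnj bit_root_mult_sign_mem unfolding label_signing_def by blast

text \<open>By linearity the two walks have the same factors except for
  \<open>bit_sign (g s t)\<close> on one and \<open>bit_sign (g t s)\<close> on the other, and these
  are opposite.\<close>

lemma label_signing_swap:
  assumes "s \<in> S" "t \<in> S" "s \<noteq> t"
  shows "label_signing g x (x + t) * label_signing g (x + t) (x + t + s)
    = - (label_signing g x (x + s) * label_signing g (x + s) (x + s + t))"
proof -
  have "bit_sign (g s t) * bit_sign (g t s) = -1"
    using g_anticomm [OF assms] by (simp add: bit_sign_def flip: bit_sign_add)
  then have "bit_sign (g s t) = - bit_sign (g t s)"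
    by (auto simp: bit_sign_def split: if_splits)
  then show ?thesis
    by (simp only: label_signing_add g_add bit_sign_add) simp
qed

lemma signed_adjacency_matrix_square:
  "signed_adjacency_matrix (cubelike_adj S) (label_signing g)
    ** signed_adjacency_matrix (cubelike_adj S) (label_signing g) = mat (of_nat (card S))"
proof -
  define M where
    "M x y = (if cubelike_adj S x y then label_signing g x y else 0)" for x y
  have "(\<Sum>y\<in>UNIV. M x y * M y z) = (if x = z then of_nat (card S) else 0)" for x z
  proof (cases "x = z")
    case True
    have "M x y * M y x = (if y \<in> {y. cubelike_adj S x y} then 1 else 0)" for y
      by (simp add: M_def label_signing_cnj [of y x] label_signing_mult_cnj cubelike_adj_def
          add.commute [of y x])
    then have "(\<Sum>y\<in>UNIV. M x y * M y x) = of_nat (card {y. cubelike_adj S x y})"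
      by (simp flip: sum.inter_filter)
    then show ?thesis
      using True regular_cubelike [of S] by (simp add: regular_graph_def)
  next
    case False
    \<comment> \<open>The two paths of length \<open>2\<close> from \<open>x\<close> to \<open>z\<close> with the same pair of labels cancel.\<close>
    have "M x (x + z + y) * M (x + z + y) z = - (M x y * M y z)" for y
    proof -
      define s t where "s = x + y" and "t = y + z"
      have y: "y = x + s" and z: "z = x + s + t" and y': "x + z + y = x + t"
        by (simp_all add: s_def t_def ac_simps)
      have "s \<noteq> t"
        using False by (auto simp: s_def t_def add.commute)
      have path: "M x (x + s) * M (x + s) (x + s + t) = (if s \<in> S \<and> t \<in> S
          then label_signing g x (x + s) * label_signing g (x + s) (x + s + t) else 0)" for s t
      proof -
        have "x + (x + s) = s" "x + s + (x + s + t) = t"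
          by (simp_all add: ac_simps)
        then show ?thesis
          by (simp only: M_def cubelike_adj_def) simp
      qed
      have "M x (x + t) * M (x + t) (x + t + s) = - (M x (x + s) * M (x + s) (x + s + t))"
        using label_signing_swap [of s t x] \<open>s \<noteq> t\<close> unfolding path by simp
      moreover have "x + t + s = z"
        by (simp add: z ac_simps)
      ultimately show ?thesis
        unfolding y' by (metis y z)
    qed
    \<comment> \<open>The map \<open>y \<mapsto> x + z + y\<close> is an involution of the vertices,
      so the sum equals its own negative.\<close>
    then have "(\<Sum>y\<in>UNIV. M x (x + z + y) * M (x + z + y) z) = - (\<Sum>y\<in>UNIV. M x y * M y z)"
      by (simp add: sum_negf)
    moreover have "(\<Sum>y\<in>UNIV. M x (x + z + y) * M (x + z + y) z) = (\<Sum>y\<in>UNIV. M x y * M y z)"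
      by (rule sum.reindex_bij_witness [of _ "(+) (x + z)" "(+) (x + z)"]) auto
    ultimately show ?thesis
      using False by simp
  qed
  then show ?thesis
    by (simp add: signed_adjacency_matrix_def matrix_matrix_mult_def mat_def vec_eq_iff M_def)
qed

lemma unitary_signing: "unitary_signing (cubelike_adj S) (label_signing g)"
  using complex_signing regular_cubelike signed_adjacency_matrix_square
  by (auto simp: unitary_signing_def)

text \<open>The two walks from \<open>v\<^sub>0\<close> to \<open>v\<^sub>2\<close> have opposite
  weights w and -w of modulus 1. The cycle runs along one and back along the other, whose weight
  gets conjugated.\<close>

lemma two_label_4cycle_sign:
  assumes "two_label_4cycle S vs"
  shows "cycle_sign (label_signing g) vs = -1"
proof -
  obtain v\<^sub>0 v\<^sub>1 v\<^sub>2 v\<^sub>3 where vs: "vs = [v\<^sub>0, v\<^sub>1, v\<^sub>2, v\<^sub>3]"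
    using assms by (auto simp: two_label_4cycle_def numeral_eq_Suc length_Suc_conv)
  obtain a b where ab: "a \<in> S" "b \<in> S" "a \<noteq> b" and labels: "cycle_labels vs = [a, b, a, b]"
    using assms by (auto simp: two_label_4cycle_def)
  have v: "v\<^sub>1 = v\<^sub>0 + a" "v\<^sub>2 = v\<^sub>1 + b" "v\<^sub>3 = v\<^sub>2 + a" "v\<^sub>0 = v\<^sub>3 + b"
  proof -
    have "v\<^sub>0 + v\<^sub>1 = a" "v\<^sub>1 + v\<^sub>2 = b" "v\<^sub>2 + v\<^sub>3 = a" "v\<^sub>3 + v\<^sub>0 = b"
      using labels by (simp_all add: vs cycle_labels_def upt_rec)
    then show "v\<^sub>1 = v\<^sub>0 + a" "v\<^sub>2 = v\<^sub>1 + b" "v\<^sub>3 = v\<^sub>2 + a" "v\<^sub>0 = v\<^sub>3 + b"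
      by (metis bit_vec_add_self_left)+
  qed
  have "length vs = 4" "{..<4::nat} = {0, 1, 2, 3}"
    by (auto simp: vs)
  then have "cycle_sign (label_signing g) vs = label_signing g v\<^sub>0 v\<^sub>1 * label_signing g v\<^sub>1 v\<^sub>2
      * (label_signing g v\<^sub>2 v\<^sub>3 * label_signing g v\<^sub>3 v\<^sub>0)"
    unfolding cycle_sign_def by (simp add: vs mult.assoc)
  also have "label_signing g v\<^sub>2 v\<^sub>3 * label_signing g v\<^sub>3 v\<^sub>0
      = cnj (label_signing g v\<^sub>0 v\<^sub>3 * label_signing g v\<^sub>3 v\<^sub>2)"
    by (simp add: label_signing_cnj [of v\<^sub>2] label_signing_cnj [of v\<^sub>3 v\<^sub>0])
  also have "label_signing g v\<^sub>0 v\<^sub>3 * label_signing g v\<^sub>3 v\<^sub>2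
      = - (label_signing g v\<^sub>0 v\<^sub>1 * label_signing g v\<^sub>1 v\<^sub>2)"
  proof -
    have "v\<^sub>3 = v\<^sub>0 + b" "v\<^sub>2 = v\<^sub>0 + b + a" "v\<^sub>2 = v\<^sub>0 + a + b" "v\<^sub>1 = v\<^sub>0 + a"
      using v by (auto simp: ac_simps)
    then show ?thesis
      using label_signing_swap [OF ab, of v\<^sub>0] by metis
  qed
  also have "label_signing g v\<^sub>0 v\<^sub>1 * label_signing g v\<^sub>1 v\<^sub>2
      * cnj (- (label_signing g v\<^sub>0 v\<^sub>1 * label_signing g v\<^sub>1 v\<^sub>2)) = -1"
    by (simp add: label_signing_def bit_root_def bit_sign_def)
  finally show ?thesis .
qed

end

theorem theorem5p4:
  fixes S :: "(bit ^ 'n::finite) set"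
  assumes "0 \<notin> S"
    and "group_closure S = UNIV"
    and "Theta_property S"
  shows "\<exists>\<sigma>. unitary_signing (cubelike_adj S) \<sigma> \<and>
             (\<forall>vs. two_label_4cycle S vs \<longrightarrow> cycle_sign \<sigma> vs = -1)"
proof -
  obtain g :: "bit ^ 'n \<Rightarrow> bit ^ 'n \<Rightarrow> bit"
    where "\<And>s x y. g s (x + y) = g s x + g s y"
      and "\<And>s t. s \<in> S \<Longrightarrow> t \<in> S \<Longrightarrow> s \<noteq> t \<Longrightarrow> g s t + g t s = 1"
    using Theta_property_functionals [OF assms(2,3)] by blast
  then interpret anticommuting_functionals S g
    by unfold_locales
  show ?thesis
    using unitary_signing two_label_4cycle_sign by blast
qed

end
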